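(* Let $f:\mathbb{D}\to\mathbb{C}$ be analytic with $A(f)=\int\!\!\int_{\mathbb{D}}|f'(z)|^2\,dx\,dy<+\infty$. Then, for any $z\in\mathbb{D}$, $$\frac{|f'(z)|}{\lambda_{\mathbb{D}}(z)}\ \leqslant\ \sqrt{\frac{A(f)}{4\pi}}.$$ Further, for each $z\in\mathbb{D}$, equality occurs (at the point $z$) when $f$ is the function $f(w)=(w-z)/(1-\bar z w)$, $w\in\mathbb{D}$.
   Context: $\mathbb{D}=\{z\in\mathbb{C}:|z|<1\}$ is the open unit disc, and $\lambda_{\mathbb{D}}(z)=2/(1-|z|^2)$ is the density of the hyperbolic metric on $\mathbb{D}$. *)

theory Defs
  imports "HOL-Complex_Analysis.Complex_Analysis"
begin

abbreviation unit_disc :: "complex set" where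
  "unit_disc \<equiv> ball 0 1"

text \<open>Density of the hyperbolic metric (curvature \<open>-1\<close>) on the unit disc.\<close>

definition hyp_density :: "complex \<Rightarrow> real" where
  "hyp_density z = 2 / (1 - (cmod z)\<^sup>2)"

text \<open>The integral of \<open>|f'|\<^sup>2\<close> over the disc is taken as an extended nonnegative
  integral, so that its finiteness is a genuine condition on \<open>f\<close>; \<open>lborel\<close> on
  \<open>complex\<close> is planar Lebesgue measure \<open>dx dy\<close>.\<close>

definition disc_area :: "(complex \<Rightarrow> complex) \<Rightarrow> ennreal" where
  "disc_area f = (\<integral>\<^sup>+ w \<in> unit_disc. ennreal ((cmod (deriv f w))\<^sup>2) \<partial>lborel)"

end

(* Write f' = sum a_n w^n.  Lebesgue measure is rotation invariant, so the monomials are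
   orthogonal on discs and A(f) = pi * sum |a_n|^2 / (n + 1).  The Cauchy-Schwarz inequality,
   with |a_n z^n| split as (|a_n| / sqrt (n + 1)) * (sqrt (n + 1) |z|^n), together with
   sum (n + 1) |z|^(2n) = 1 / (1 - |z|^2)^2, gives the bound; for the disc automorphism
   a_n = (1 - |z|^2) (n + 1) (cnj z)^n, so that A(f) = pi. *)

theory Submission
  imports Defs
begin

section \<open>Invariance of Lebesgue measure under translations and orthogonal maps\<close>

lemma nn_integral_lborel_translate:
  fixes f :: "'a::euclidean_space \<Rightarrow> ennreal"
  assumes [measurable]: "f \<in> borel_measurable borel"
  shows "(\<integral>\<^sup>+x. f (c + x) \<partial>lborel) = (\<integral>\<^sup>+x. f x \<partial>lborel)"
proof -
  have "(\<integral>\<^sup>+x. f x \<partial>lborel) = (\<integral>\<^sup>+x. f x \<partial>distr lborel borel ((+) c))"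
    by (simp add: lborel_distr_plus)
  also have "\<dots> = (\<integral>\<^sup>+x. f (c + x) \<partial>lborel)"
    by (rule nn_integral_distr) auto
  finally show ?thesis by simp
qed

text \<open>Uniqueness of translation-invariant measures: evaluate
  \<open>\<integral>\<integral> 1\<^sub>B(x) 1\<^sub>A(x + T y)\<close> in both orders, with \<open>B\<close> the unit ball, whose translates all have
  the same measure under \<open>T\<close>.\<close>

lemma lborel_distr_orthogonal_transformation:
  fixes T :: "'a::euclidean_space \<Rightarrow> 'a"
  assumes T: "orthogonal_transformation T"
  shows "distr lborel borel T = lborel"
proof (rule measure_eqI)
  fix A assume "A \<in> sets (distr lborel borel T)"
  then have A[measurable]: "A \<in> sets borel" by simp
  have lin: "linear T" by (rule orthogonal_transformation_linear[OF T])
  have [measurable]: "T \<in> borel_measurable borel"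
    using lin by (intro borel_measurable_continuous_onI linear_continuous_on)
       (simp add: linear_conv_bounded_linear)
  let ?B = "ball 0 1 :: 'a set"
  let ?v = "emeasure lborel ?B"
  have [measurable]: "?B \<in> sets borel" by simp
  have v: "?v \<noteq> 0" "?v \<noteq> \<infinity>"
    using unit_ball_vol_pos[of "real DIM('a)"] by (simp_all add: emeasure_ball del: unit_ball_vol_pos)
  \<comment> \<open>Since \<open>x = T u\<close> gives \<open>x + T y = T (u + y)\<close>,
    translating \<open>y\<close> by \<open>u\<close> removes \<open>x\<close>.\<close>
  have shift: "(\<integral>\<^sup>+y. indicator A (x + T y) \<partial>lborel) = (\<integral>\<^sup>+y. indicator A (T y) \<partial>lborel)" for x
  proof -
    obtain u where u: "x = T u"
      using orthogonal_transformation_surj[OF T] by blast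
    show ?thesis
      using nn_integral_lborel_translate[of "\<lambda>y. indicator A (T y)" u]
      by (simp add: u linear_add[OF lin])
  qed
  \<comment> \<open>The \<open>y\<close> with \<open>T y\<close> at distance less than 1 from
    \<open>T u\<close> form the unit ball around \<open>u\<close>, because \<open>T\<close> is an
    isometry.\<close>
  have ball_vol: "(\<integral>\<^sup>+y. indicator ?B (x - T y) \<partial>lborel) = ?v" for x
  proof -
    obtain u where u: "x = T u"
      using orthogonal_transformation_surj[OF T] by blast
    have "norm (T u - T y) = norm (u - y)" for y
      using orthogonal_transformation_norm[OF T, of "u - y"] by (simp add: linear_diff[OF lin])
    then have "(\<integral>\<^sup>+y. indicator ?B (x - T y) \<partial>lborel) = (\<integral>\<^sup>+y. indicator (ball u 1) y \<partial>lborel)"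
      by (intro nn_integral_cong) (auto simp: u dist_norm norm_minus_commute indicator_def)
    also have "\<dots> = emeasure lborel (ball u 1)"
      by simp
    also have "\<dots> = ?v"
      by (simp add: emeasure_ball)
    finally show ?thesis .
  qed
  have "?v * emeasure (distr lborel borel T) A
      = (\<integral>\<^sup>+x. indicator ?B x * (\<integral>\<^sup>+y. indicator A (T y) \<partial>lborel) \<partial>lborel)"
  proof -
    have "emeasure (distr lborel borel T) A = (\<integral>\<^sup>+y. indicator A y \<partial>distr lborel borel T)"
      by simp
    also have "\<dots> = (\<integral>\<^sup>+y. indicator A (T y) \<partial>lborel)"
      by (rule nn_integral_distr) auto
    finally show ?thesis
      by (simp add: nn_integral_multc)
  qed
  also have "\<dots> = (\<integral>\<^sup>+x. (\<integral>\<^sup>+y. indicator ?B x * indicator A (x + T y) \<partial>lborel) \<partial>lborel)"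
    by (simp add: shift nn_integral_cmult)
  also have "\<dots> = (\<integral>\<^sup>+y. (\<integral>\<^sup>+x. indicator ?B x * indicator A (x + T y) \<partial>lborel) \<partial>lborel)"
    by (rule lborel_pair.Fubini') measurable
  \<comment> \<open>Translating \<open>x\<close> by \<open>- T y\<close> moves \<open>T\<close> from
    the argument of \<open>A\<close> to that of the ball, where \<open>ball_vol\<close> can absorb
    it.\<close>
  also have "\<dots> = (\<integral>\<^sup>+y. (\<integral>\<^sup>+x. indicator ?B (x - T y) * indicator A x \<partial>lborel) \<partial>lborel)"
  proof (rule nn_integral_cong)
    fix y
    show "(\<integral>\<^sup>+x. indicator ?B x * indicator A (x + T y) \<partial>lborel)
        = (\<integral>\<^sup>+x. indicator ?B (x - T y) * indicator A x \<partial>lborel)"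
      using nn_integral_lborel_translate[of "\<lambda>x. indicator ?B x * indicator A (x + T y)" "- T y"]
      by simp
  qed
  also have "\<dots> = (\<integral>\<^sup>+x. (\<integral>\<^sup>+y. indicator ?B (x - T y) * indicator A x \<partial>lborel) \<partial>lborel)"
    by (rule lborel_pair.Fubini') measurable
  also have "\<dots> = ?v * emeasure lborel A"
    by (simp add: ball_vol nn_integral_multc nn_integral_cmult del: mem_ball)
  finally show "emeasure (distr lborel borel T) A = emeasure lborel A"
    using v by (simp add: ennreal_mult_cancel_left)
qed simp

section \<open>Orthogonality and norms of the monomials on discs\<close>

text \<open>A rotation by \<open>c\<close> with \<open>c^(n - m) = -1\<close> changes the sign of the integral.\<close>

lemma integral_disc_monomials_orthogonal:
  assumes "n \<noteq> m"
  shows "(\<integral>w. indicator (ball 0 r) w *\<^sub>R (w ^ n * cnj w ^ m) \<partial>lborel) = (0::complex)"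
proof -
  \<comment> \<open>The difference of the exponents is taken in the reals, so \<open>n < m\<close>
    needs no separate treatment; \<open>cnj c ^ m\<close> stands for \<open>c\<close> to the power
    \<open>-m\<close>.\<close>
  define c where "c = cis (pi / (real n - real m))"
  define h :: "complex \<Rightarrow> complex" where "h w = indicator (ball 0 r) w *\<^sub>R (w ^ n * cnj w ^ m)" for w
  have norm_c: "norm c = 1" by (simp add: c_def)
  have "c ^ n * cnj c ^ m = cis (real n * (pi / (real n - real m)) + - (real m * (pi / (real n - real m))))"
    by (simp only: c_def Complex.DeMoivre cis_mult cis_cnj minus_mult_right)
  also have "real n * (pi / (real n - real m)) + - (real m * (pi / (real n - real m))) = pi"
    using assms by (simp flip: left_diff_distrib diff_divide_distrib)
  finally have c: "c ^ n * cnj c ^ m = -1" by simp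
  have [measurable]: "ball 0 r \<in> sets (borel :: complex measure)" by simp
  have [measurable]: "cnj \<in> borel_measurable borel"
    by (intro borel_measurable_continuous_onI continuous_intros)
  have [measurable]: "h \<in> borel_measurable borel"
    unfolding h_def by measurable
  have "orthogonal_transformation ((*) c)"
    unfolding orthogonal_transformation
    by (auto simp: norm_mult norm_c algebra_simps linear_iff)
  then have "(\<integral>w. h w \<partial>lborel) = (\<integral>w. h w \<partial>distr lborel borel ((*) c))"
    by (simp add: lborel_distr_orthogonal_transformation)
  also have "\<dots> = (\<integral>w. h (c * w) \<partial>lborel)"
    by (rule integral_distr) auto
  also have "\<dots> = (\<integral>w. - h w \<partial>lborel)"
  proof (rule Bochner_Integration.integral_cong)
    fix w
    have "indicator (ball 0 r) (c * w) = (indicator (ball 0 r) w :: real)"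
      by (simp add: indicator_def norm_mult norm_c)
    moreover have "(c * w) ^ n * cnj (c * w) ^ m = (c ^ n * cnj c ^ m) * (w ^ n * cnj w ^ m)"
      by (simp add: power_mult_distrib mult_ac)
    ultimately show "h (c * w) = - h w"
      by (simp only: h_def c) simp
  qed simp
  also have "\<dots> = - (\<integral>w. h w \<partial>lborel)" by simp
  finally show ?thesis
    by (simp add: h_def)
qed

text \<open>Layer-cake argument in place of polar coordinates: write \<open>cmod w ^ (2 * n)\<close>
  as the integral of \<open>d s\<close> over \<open>s\<close> from 0 to \<open>cmod w\<close> and
  exchange the integrals. The inner integral becomes the area of an annulus, leaving a polynomial in
  \<open>s\<close>.\<close>

lemma nn_integral_disc_even_power:
  assumes r: "0 \<le> r"
  shows "(\<integral>\<^sup>+ w \<in> ball 0 r. ennreal (cmod w ^ (2 * n)) \<partial>lborel)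
       = ennreal (pi * r ^ (2 * n + 2) / (real n + 1))"
\<comment> \<open>The layer formula fails for \<open>n = 0\<close>, where \<open>d\<close> vanishes
  but \<open>0 ^ 0 = 1\<close>; that case is just the area of the disc.\<close>
proof (cases "n = 0")
  case True
  then show ?thesis using r
    by (simp add: emeasure_ball unit_ball_vol_2 ennreal_mult power2_eq_square)
next
  case n: False
  define d where "d s = 2 * real n * s ^ (2 * n - 1)" for s :: real
  \<comment> \<open>An antiderivative of \<open>d s * (pi * (r\<^sup>2 - s\<^sup>2))\<close>, the
    weight times the area of the annulus.\<close>
  define F where "F s = pi * (r\<^sup>2 * s ^ (2 * n) - real n / (real n + 1) * s ^ (2 * n + 2))" for s :: real
  have d_nonneg: "0 \<le> d s" if "0 \<le> s" for s
    using that by (simp add: d_def)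
  have [measurable]: "d \<in> borel_measurable borel"
    unfolding d_def by measurable
  have layer: "ennreal (cmod w ^ (2 * n)) = (\<integral>\<^sup>+ s. ennreal (d s) * indicator {0..cmod w} s \<partial>lborel)" for w
  proof -
    have "((\<lambda>s. s ^ (2 * n)) has_real_derivative d s) (at s)" for s
      unfolding d_def by (rule derivative_eq_intros refl | simp)+
    then have "(\<integral>\<^sup>+ s. ennreal (d s) * indicator {0..cmod w} s \<partial>lborel)
        = ennreal (cmod w ^ (2 * n) - 0 ^ (2 * n))"
      by (intro nn_integral_FTC_Icc) (auto simp: d_nonneg)
    then show ?thesis using n by simp
  qed
  have annulus: "emeasure lborel (ball 0 r - ball 0 s :: complex set) = ennreal (pi * (r\<^sup>2 - s\<^sup>2))"
    if "0 \<le> s" "s \<le> r" for s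
    using that r
    by (subst emeasure_Diff)
      (auto simp: emeasure_ball unit_ball_vol_2 ennreal_minus ennreal_mult[symmetric] algebra_simps)
  have "(\<integral>\<^sup>+ w \<in> ball 0 r. ennreal (cmod w ^ (2 * n)) \<partial>lborel)
      = (\<integral>\<^sup>+ w. (\<integral>\<^sup>+ s. ennreal (d s) * indicator {0..cmod w} s * indicator (ball 0 r) w \<partial>lborel) \<partial>lborel)"
    unfolding layer by (subst nn_integral_multc) auto
  \<comment> \<open>The conditions \<open>s \<le> cmod w\<close> and \<open>cmod w < r\<close> force
    \<open>s \<le> r\<close> and say that \<open>w\<close> lies in the annulus, so the range of
    \<open>s\<close> no longer depends on \<open>w\<close>.\<close>
  also have "\<dots> = (\<integral>\<^sup>+ w. (\<integral>\<^sup>+ s. ennreal (d s) * indicator {0..r} s * indicator (ball 0 r - ball 0 s) (w::complex) \<partial>lborel) \<partial>lborel)"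
    by (intro nn_integral_cong) (auto simp: indicator_def)
  also have "\<dots> = (\<integral>\<^sup>+ s. (\<integral>\<^sup>+ w. ennreal (d s) * indicator {0..r} s * indicator (ball 0 r - ball 0 s) (w::complex) \<partial>lborel) \<partial>lborel)"
  proof (rule lborel_pair.Fubini')
    \<comment> \<open>The annulus varies with \<open>s\<close>; spelled out as inequalities, its
      indicator is visibly measurable jointly in \<open>s\<close> and \<open>w\<close>.\<close>
    have "(\<lambda>(s, w::complex). ennreal (d s) * indicator {0..r} s * indicator (ball 0 r - ball 0 s) w)
        = (\<lambda>(s, w). ennreal (d s) * indicator {0..r} s * (if cmod w < r \<and> \<not> cmod w < s then 1 else 0))"
      by (auto simp: fun_eq_iff indicator_def)
    also have "\<dots> \<in> borel_measurable (lborel \<Otimes>\<^sub>M lborel)"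
      by measurable
    finally show "(\<lambda>(s, w::complex). ennreal (d s) * indicator {0..r} s * indicator (ball 0 r - ball 0 s) w)
        \<in> borel_measurable (lborel \<Otimes>\<^sub>M lborel)" .
  qed
  also have "\<dots> = (\<integral>\<^sup>+ s. ennreal (d s * (pi * (r\<^sup>2 - s\<^sup>2))) * indicator {0..r} s \<partial>lborel)"
    by (intro nn_integral_cong)
      (auto simp: nn_integral_cmult_indicator annulus d_nonneg ennreal_mult' split: split_indicator)
  also have "\<dots> = ennreal (F r - F 0)"
  proof (rule nn_integral_FTC_Icc)
    fix s :: real
    assume "s \<in> {0..r}"
    then show "0 \<le> d s * (pi * (r\<^sup>2 - s\<^sup>2))"
      by (intro mult_nonneg_nonneg d_nonneg) (auto intro: power_mono)
    \<comment> \<open>With \<open>n = Suc k\<close> the natural-number subtraction in the exponent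
      \<open>2 * n - 1\<close> can be evaluated.\<close>
    obtain k where k: "n = Suc k" using n by (cases n) auto
    show "(F has_real_derivative d s * (pi * (r\<^sup>2 - s\<^sup>2))) (at s)"
      unfolding F_def d_def k
      by (rule derivative_eq_intros refl | simp)+ (simp add: divide_simps, simp add: algebra_simps power2_eq_square)
  qed (use r in auto)
  also have "F r - F 0 = pi * r ^ (2 * n + 2) / (real n + 1)"
  proof -
    have "F 0 = 0" using n by (simp add: F_def)
    moreover have "F r = pi * r ^ (2 * n + 2) / (real n + 1)"
      by (simp add: F_def field_simps power2_eq_square)
    ultimately show ?thesis by simp
  qed
  finally show ?thesis .
qed

section \<open>Parseval's formula for power series on discs\<close>

lemma integrable_bounded_on_ball:
  fixes h :: "'a::euclidean_space \<Rightarrow> 'b::{banach, second_countable_topology}"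
  assumes [measurable]: "h \<in> borel_measurable borel"
    and bound: "\<And>w. w \<in> ball c r \<Longrightarrow> norm (h w) \<le> B"
  shows "integrable lborel (\<lambda>w. indicator (ball c r) w *\<^sub>R h w)"
proof (rule integrableI_bounded_set_indicator)
  show "AE w in lborel. w \<in> ball c r \<longrightarrow> norm (h w) \<le> B"
    using bound by auto
  show "emeasure lborel (ball c r) < \<infinity>"
    by (cases "0 \<le> r") (auto simp: emeasure_ball ennreal_mult_less_top less_top ball_empty)
qed auto

text \<open>Orthogonality gives the formula for the partial sums. As \<open>r < R\<close>, these are
  bounded on the smaller disc by the constant \<open>M\<close>, so dominated convergence carries the
  formula over to \<open>g\<close>.\<close>

lemma nn_integral_subdisc_power_series:
  fixes a :: "nat \<Rightarrow> complex"
  assumes r: "0 < r" "r < R"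
    and sums: "\<And>w. w \<in> ball 0 R \<Longrightarrow> (\<lambda>n. a n * w ^ n) sums g w"
  shows "(\<integral>\<^sup>+ w \<in> ball 0 r. ennreal ((cmod (g w))\<^sup>2) \<partial>lborel)
       = (\<Sum>n. ennreal ((cmod (a n))\<^sup>2 * (pi * r ^ (2 * n + 2) / (real n + 1))))"
proof -
  let ?I = "\<lambda>w. indicator (ball 0 r) w :: real"
  define S where "S N w = (\<Sum>n<N. a n * w ^ n)" for N and w :: complex
  define M where "M = (\<Sum>n. cmod (a n) * r ^ n)"
  have summ: "summable (\<lambda>n. cmod (a n) * r ^ n)"
  proof -
    \<comment> \<open>Convergence at the midpoint, strictly between \<open>r\<close> and
      \<open>R\<close>, yields absolute convergence at \<open>r\<close>.\<close>
    have "summable (\<lambda>n. a n * of_real ((r + R) / 2) ^ n)"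
      using r by (intro sums_summable[OF sums]) (auto simp del: of_real_add of_real_divide)
    from powser_insidea[OF this, of "of_real r"] show ?thesis
      using r by (simp add: norm_mult norm_power del: of_real_add of_real_divide)
  qed
  have [measurable]: "ball 0 r \<in> sets (borel :: complex measure)" by simp
  have [measurable]: "cnj \<in> borel_measurable borel"
    by (intro borel_measurable_continuous_onI continuous_intros)
  have S_bound: "cmod (S N w) \<le> M" if "w \<in> ball 0 r" for N w
  proof -
    have "cmod (S N w) \<le> (\<Sum>n<N. cmod (a n) * r ^ n)"
      unfolding S_def using that
      by (intro sum_norm_le) (auto simp: norm_mult norm_power intro!: mult_left_mono power_mono)
    also have "\<dots> \<le> M"
      unfolding M_def using r by (intro sum_le_suminf summ) auto
    finally show ?thesis .
  qed
  have S_lim: "(\<lambda>N. S N w) \<longlonglongrightarrow> g w" if "w \<in> ball 0 r" for w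
    using sums[of w] that r unfolding sums_def S_def by auto
  have [measurable]: "S N \<in> borel_measurable borel" for N
    unfolding S_def by measurable
  have moment: "(\<integral>w. ?I w *\<^sub>R (w ^ n * cnj w ^ n) \<partial>lborel)
      = complex_of_real (pi * r ^ (2 * n + 2) / (real n + 1))" for n
  proof -
    have "(\<integral>w. ?I w *\<^sub>R (w ^ n * cnj w ^ n) \<partial>lborel)
        = (\<integral>w. complex_of_real (?I w * cmod w ^ (2 * n)) \<partial>lborel)"
      by (intro Bochner_Integration.integral_cong)
        (auto simp: power_mult_distrib[symmetric] complex_norm_square[symmetric] power_mult scaleR_conv_of_real)
    also have "\<dots> = complex_of_real (\<integral>w. ?I w * cmod w ^ (2 * n) \<partial>lborel)"
      by (rule integral_complex_of_real)
    also have "(\<integral>w. ?I w * cmod w ^ (2 * n) \<partial>lborel)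
        = enn2real (\<integral>\<^sup>+ w. ennreal (?I w * cmod w ^ (2 * n)) \<partial>lborel)"
      by (rule integral_eq_nn_integral) measurable
    also have "(\<integral>\<^sup>+ w. ennreal (?I w * cmod w ^ (2 * n)) \<partial>lborel)
        = (\<integral>\<^sup>+ w \<in> ball 0 r. ennreal (cmod w ^ (2 * n)) \<partial>lborel)"
      by (intro nn_integral_cong) (auto split: split_indicator)
    also have "\<dots> = ennreal (pi * r ^ (2 * n + 2) / (real n + 1))"
      using r by (intro nn_integral_disc_even_power) auto
    finally show ?thesis using r by simp
  qed
  have int_mono: "integrable lborel (\<lambda>w. ?I w *\<^sub>R (w ^ n * cnj w ^ m))" for n m
    by (rule integrable_bounded_on_ball[where B = "r ^ n * r ^ m"], measurable)
      (use r in \<open>auto simp: norm_mult norm_power intro!: mult_mono power_mono\<close>)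
  have S_sq: "complex_of_real ((cmod (S N w))\<^sup>2)
      = (\<Sum>n<N. \<Sum>m<N. (a n * cnj (a m)) * (w ^ n * cnj w ^ m))" for N w
    unfolding complex_norm_square S_def cnj_sum sum_product
    by (intro sum.cong refl) (simp add: mult_ac)
  have S_int: "(\<integral>w. ?I w * (cmod (S N w))\<^sup>2 \<partial>lborel)
      = (\<Sum>n<N. (cmod (a n))\<^sup>2 * (pi * r ^ (2 * n + 2) / (real n + 1)))" for N
  proof -
    \<comment> \<open>The computation runs in the complex numbers because the cross terms
      \<open>a n * cnj (a m)\<close> are complex; injectivity of the embedding brings it back to the
      reals.\<close>
    have "complex_of_real (\<integral>w. ?I w * (cmod (S N w))\<^sup>2 \<partial>lborel)
        = (\<integral>w. complex_of_real (?I w * (cmod (S N w))\<^sup>2) \<partial>lborel)"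
      by (rule integral_complex_of_real[symmetric])
    also have "\<dots> = (\<integral>w. (\<Sum>n<N. \<Sum>m<N. (a n * cnj (a m)) * (?I w *\<^sub>R (w ^ n * cnj w ^ m))) \<partial>lborel)"
      by (intro Bochner_Integration.integral_cong)
        (auto simp: S_sq scaleR_conv_of_real simp del: of_real_power split: split_indicator)
    also have "\<dots> = (\<Sum>n<N. \<Sum>m<N. (a n * cnj (a m)) * (\<integral>w. ?I w *\<^sub>R (w ^ n * cnj w ^ m) \<partial>lborel))"
      by (simp only: Bochner_Integration.integral_sum Bochner_Integration.integrable_sum
          integrable_mult_right integral_mult_right_zero int_mono)
    also have "\<dots> = (\<Sum>n<N. \<Sum>m<N. if m = n then complex_of_real ((cmod (a n))\<^sup>2 * (pi * r ^ (2 * n + 2) / (real n + 1))) else 0)"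
    proof (intro sum.cong refl)
      fix n m
      show "(a n * cnj (a m)) * (\<integral>w. ?I w *\<^sub>R (w ^ n * cnj w ^ m) \<partial>lborel)
          = (if m = n then complex_of_real ((cmod (a n))\<^sup>2 * (pi * r ^ (2 * n + 2) / (real n + 1))) else 0)"
        using integral_disc_monomials_orthogonal[of n m r]
        by (cases "m = n") (simp_all only: moment of_real_mult complex_norm_square if_True if_False mult_zero_right simp_thms)
    qed
    also have "\<dots> = complex_of_real (\<Sum>n<N. (cmod (a n))\<^sup>2 * (pi * r ^ (2 * n + 2) / (real n + 1)))"
      by simp
    finally show ?thesis by (simp only: of_real_eq_iff)
  qed
  \<comment> \<open>Nothing is known of \<open>g\<close> outside the disc of convergence, so
    measurability is obtained only for the truncated function, as a pointwise limit.\<close>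
  have [measurable]: "(\<lambda>w. ?I w * (cmod (g w))\<^sup>2) \<in> borel_measurable borel"
    by (rule borel_measurable_LIMSEQ_real[where u = "\<lambda>N w. ?I w * (cmod (S N w))\<^sup>2"])
      (auto intro!: tendsto_intros S_lim split: split_indicator)
  have lim: "(\<lambda>N. \<integral>w. ?I w * (cmod (S N w))\<^sup>2 \<partial>lborel) \<longlonglongrightarrow> (\<integral>w. ?I w * (cmod (g w))\<^sup>2 \<partial>lborel)"
    and int_g: "integrable lborel (\<lambda>w. ?I w * (cmod (g w))\<^sup>2)"
  proof -
    have dom: "integrable lborel (\<lambda>w. ?I w * M\<^sup>2)"
      using integrable_bounded_on_ball[of "\<lambda>_. M\<^sup>2" 0 r "M\<^sup>2"] by simp
    have conv: "AE w in lborel. (\<lambda>N. ?I w * (cmod (S N w))\<^sup>2) \<longlonglongrightarrow> ?I w * (cmod (g w))\<^sup>2"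
      by (auto intro!: tendsto_intros S_lim split: split_indicator)
    have bound: "AE w in lborel. norm (?I w * (cmod (S N w))\<^sup>2) \<le> ?I w * M\<^sup>2" for N
      using S_bound by (auto intro!: power_mono split: split_indicator)
    show "(\<lambda>N. \<integral>w. ?I w * (cmod (S N w))\<^sup>2 \<partial>lborel) \<longlonglongrightarrow> (\<integral>w. ?I w * (cmod (g w))\<^sup>2 \<partial>lborel)"
      by (rule integral_dominated_convergence[OF _ _ dom conv bound]) auto
    show "integrable lborel (\<lambda>w. ?I w * (cmod (g w))\<^sup>2)"
      by (rule integrable_dominated_convergence[OF _ _ dom conv bound]) auto
  qed
  have "(\<lambda>n. (cmod (a n))\<^sup>2 * (pi * r ^ (2 * n + 2) / (real n + 1)))
      sums (\<integral>w. ?I w * (cmod (g w))\<^sup>2 \<partial>lborel)"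
    using lim unfolding sums_def S_int .
  then have "(\<Sum>n. ennreal ((cmod (a n))\<^sup>2 * (pi * r ^ (2 * n + 2) / (real n + 1))))
      = ennreal (\<integral>w. ?I w * (cmod (g w))\<^sup>2 \<partial>lborel)"
    using r by (intro suminf_ennreal_eq) auto
  also have "\<dots> = (\<integral>\<^sup>+ w. ennreal (?I w * (cmod (g w))\<^sup>2) \<partial>lborel)"
    by (rule nn_integral_eq_integral[symmetric, OF int_g]) auto
  also have "\<dots> = (\<integral>\<^sup>+ w \<in> ball 0 r. ennreal ((cmod (g w))\<^sup>2) \<partial>lborel)"
    by (intro nn_integral_cong) (auto split: split_indicator)
  finally show ?thesis by simp
qed

text \<open>Exhaust the disc by smaller concentric ones. Both sides are suprema over their radii, by
  monotone convergence for the integral and for the series, so the identity also holds when both are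
  infinite.\<close>

lemma nn_integral_disc_power_series:
  fixes a :: "nat \<Rightarrow> complex"
  assumes R: "0 < R"
    and sums: "\<And>w. w \<in> ball 0 R \<Longrightarrow> (\<lambda>n. a n * w ^ n) sums g w"
  shows "(\<integral>\<^sup>+ w \<in> ball 0 R. ennreal ((cmod (g w))\<^sup>2) \<partial>lborel)
       = (\<Sum>n. ennreal ((cmod (a n))\<^sup>2 * (pi * R ^ (2 * n + 2) / (real n + 1))))"
proof -
  \<comment> \<open>Radii increasing to \<open>R\<close>; the shift by 2 makes the first one
    \<open>R / 2\<close>, hence positive.\<close>
  define r where "r k = R * (1 - inverse (real k + 2))" for k :: nat
  have r_pos: "0 < r k" and r_less: "r k < R" for k
    using R by (auto simp: r_def inverse_less_1_iff)
  have r_mono: "r i \<le> r j" if "i \<le> j" for i j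
    using R that unfolding r_def by (intro mult_left_mono diff_left_mono le_imp_inverse_le) auto
  have incseq_term: "incseq (\<lambda>k. ennreal ((cmod (a n))\<^sup>2 * (pi * r k ^ (2 * n + 2) / (real n + 1))))" for n
    unfolding incseq_def
    by (intro allI impI ennreal_leI mult_left_mono divide_right_mono power_mono r_mono less_imp_le[OF r_pos]) auto
  have "r \<longlonglongrightarrow> R * (1 - 0)"
    unfolding r_def by (intro tendsto_intros) real_asymp
  then have r_lim: "r \<longlonglongrightarrow> R" by simp
  have [measurable]: "ball 0 (r k) \<in> sets (borel :: complex measure)" for k by simp
  have g_meas: "(\<lambda>w. ennreal ((cmod (g w))\<^sup>2) * indicator (ball 0 (r k)) w) \<in> borel_measurable borel" for k
  proof (rule borel_measurable_LIMSEQ_order)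
    show "(\<lambda>w. ennreal ((cmod (\<Sum>n<N. a n * w ^ n))\<^sup>2) * indicator (ball 0 (r k)) w) \<in> borel_measurable borel" for N
      by measurable
    show "(\<lambda>N. ennreal ((cmod (\<Sum>n<N. a n * w ^ n))\<^sup>2) * indicator (ball 0 (r k)) w)
        \<longlonglongrightarrow> ennreal ((cmod (g w))\<^sup>2) * indicator (ball 0 (r k)) w" for w
      using sums[of w] r_less[of k] unfolding sums_def
      by (auto intro!: tendsto_intros split: split_indicator)
  qed
  have "(\<integral>\<^sup>+ w \<in> ball 0 R. ennreal ((cmod (g w))\<^sup>2) \<partial>lborel)
      = (\<integral>\<^sup>+ w. (SUP k. ennreal ((cmod (g w))\<^sup>2) * indicator (ball 0 (r k)) w) \<partial>lborel)"
  proof (intro nn_integral_cong antisym)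
    fix w
    show "ennreal ((cmod (g w))\<^sup>2) * indicator (ball 0 R) w
        \<le> (SUP k. ennreal ((cmod (g w))\<^sup>2) * indicator (ball 0 (r k)) w)"
    proof (cases "w \<in> ball 0 R")
      case True
      then have "eventually (\<lambda>k. cmod w < r k) sequentially"
        by (intro order_tendstoD(1)[OF r_lim]) auto
      then obtain k where "cmod w < r k"
        by (auto simp: eventually_sequentially)
      then show ?thesis
        by (intro SUP_upper2[of k]) (use True in auto)
    qed auto
    show "(SUP k. ennreal ((cmod (g w))\<^sup>2) * indicator (ball 0 (r k)) w)
        \<le> ennreal ((cmod (g w))\<^sup>2) * indicator (ball 0 R) w"
      by (intro SUP_least) (auto split: split_indicator dest: order.strict_trans[OF _ r_less])
  qed
  also have "\<dots> = (SUP k. \<integral>\<^sup>+ w \<in> ball 0 (r k). ennreal ((cmod (g w))\<^sup>2) \<partial>lborel)"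
    by (intro nn_integral_monotone_convergence_SUP)
      (auto simp: incseq_def le_fun_def g_meas split: split_indicator dest: order.strict_trans2[OF _ r_mono])
  also have "\<dots> = (SUP k. \<Sum>n. ennreal ((cmod (a n))\<^sup>2 * (pi * r k ^ (2 * n + 2) / (real n + 1))))"
    using r_pos r_less sums by (intro SUP_cong refl nn_integral_subdisc_power_series) auto
  \<comment> \<open>Supremum and sum commute because every term increases with
    \<open>k\<close>.\<close>
  also have "\<dots> = (\<Sum>n. SUP k. ennreal ((cmod (a n))\<^sup>2 * (pi * r k ^ (2 * n + 2) / (real n + 1))))"
    by (intro ennreal_suminf_SUP_eq[symmetric] incseq_term)
  also have "\<dots> = (\<Sum>n. ennreal ((cmod (a n))\<^sup>2 * (pi * R ^ (2 * n + 2) / (real n + 1))))"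
  proof (intro suminf_cong LIMSEQ_unique[OF LIMSEQ_SUP])
    fix n
    show "incseq (\<lambda>k. ennreal ((cmod (a n))\<^sup>2 * (pi * r k ^ (2 * n + 2) / (real n + 1))))"
      by (rule incseq_term)
    show "(\<lambda>k. ennreal ((cmod (a n))\<^sup>2 * (pi * r k ^ (2 * n + 2) / (real n + 1))))
        \<longlonglongrightarrow> ennreal ((cmod (a n))\<^sup>2 * (pi * R ^ (2 * n + 2) / (real n + 1)))"
      by (intro tendsto_ennrealI tendsto_intros r_lim) auto
  qed
  finally show ?thesis .
qed

lemma disc_area_power_series:
  assumes "\<And>w. w \<in> unit_disc \<Longrightarrow> (\<lambda>n. a n * w ^ n) sums deriv f w"
  shows "disc_area f = (\<Sum>n. ennreal (pi * (cmod (a n))\<^sup>2 / (real n + 1)))"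
  unfolding disc_area_def
  by (subst nn_integral_disc_power_series[OF _ assms]) (auto simp: mult_ac)

section \<open>The pointwise bound\<close>

lemma power_series_Cauchy_Schwarz:
  fixes a :: "nat \<Rightarrow> complex"
  assumes z: "cmod z < 1" and g: "(\<lambda>n. a n * z ^ n) sums w"
    and A: "summable (\<lambda>n. (cmod (a n))\<^sup>2 / (real n + 1))"
  shows "(cmod w * (1 - (cmod z)\<^sup>2))\<^sup>2 \<le> (\<Sum>n. (cmod (a n))\<^sup>2 / (real n + 1))"
proof -
  let ?A = "\<Sum>n. (cmod (a n))\<^sup>2 / (real n + 1)" and ?x = "(cmod z)\<^sup>2"
  have x: "?x < 1" using z by (simp add: abs_square_less_1)
  \<comment> \<open>The differentiated geometric series at \<open>?x\<close>; up to the factor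
    \<open>pi\<close>, its sum is the diagonal value of the Bergman kernel of the disc.\<close>
  have K: "(\<lambda>n. real (Suc n) * ?x ^ n) sums (1 / (1 - ?x)\<^sup>2)"
    using x by (intro geometric_deriv_sums) auto
  \<comment> \<open>A bound uniform in \<open>N\<close>, so that Cauchy-Schwarz is needed for finite
    sums only and the limit is taken afterwards.\<close>
  have "(cmod (\<Sum>n<N. a n * z ^ n))\<^sup>2 \<le> ?A * (1 / (1 - ?x)\<^sup>2)" for N
  proof -
    have "cmod (\<Sum>n<N. a n * z ^ n)
        \<le> (\<Sum>n<N. (cmod (a n) / sqrt (real n + 1)) * (sqrt (real n + 1) * cmod z ^ n))"
      by (intro sum_norm_le) (simp add: norm_mult norm_power)
    then have "(cmod (\<Sum>n<N. a n * z ^ n))\<^sup>2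
        \<le> (\<Sum>n<N. (cmod (a n) / sqrt (real n + 1)) * (sqrt (real n + 1) * cmod z ^ n))\<^sup>2"
      by (intro power_mono) auto
    also have "\<dots> \<le> (\<Sum>n<N. (cmod (a n) / sqrt (real n + 1))\<^sup>2) * (\<Sum>n<N. (sqrt (real n + 1) * cmod z ^ n)\<^sup>2)"
      by (rule Cauchy_Schwarz_ineq_sum)
    also have "\<dots> = (\<Sum>n<N. (cmod (a n))\<^sup>2 / (real n + 1)) * (\<Sum>n<N. real (Suc n) * ?x ^ n)"
      by (simp add: power_divide power_mult_distrib power_mult[symmetric] mult.commute add.commute)
    also have "\<dots> \<le> ?A * (1 / (1 - ?x)\<^sup>2)"
      unfolding sums_unique[OF K]
      by (intro mult_mono sum_le_suminf A sums_summable[OF K] suminf_nonneg sum_nonneg) auto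
    finally show ?thesis .
  qed
  moreover have "(\<lambda>N. (cmod (\<Sum>n<N. a n * z ^ n))\<^sup>2) \<longlonglongrightarrow> (cmod w)\<^sup>2"
    using g unfolding sums_def by (intro tendsto_intros)
  ultimately have "(cmod w)\<^sup>2 \<le> ?A * (1 / (1 - ?x)\<^sup>2)"
    by (intro LIMSEQ_le_const2) auto
  then show ?thesis
    using x by (simp add: pos_le_divide_eq power_mult_distrib)
qed

lemma dirichlet_bound:
  assumes f: "f analytic_on unit_disc" and fin: "disc_area f < \<infinity>" and z: "z \<in> unit_disc"
  shows "cmod (deriv f z) / hyp_density z \<le> sqrt (enn2real (disc_area f) / (4 * pi))"
proof -
  \<comment> \<open>Taylor coefficients of \<open>deriv f\<close>, not of \<open>f\<close>.\<close>
  define a where "a n = (deriv ^^ n) (deriv f) 0 / fact n" for n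
  have "f holomorphic_on unit_disc"
    using f by (simp add: analytic_on_open)
  then have "deriv f holomorphic_on unit_disc"
    by (intro holomorphic_deriv) auto
  then have sums: "(\<lambda>n. a n * w ^ n) sums deriv f w" if "w \<in> unit_disc" for w
    using holomorphic_power_series[of "deriv f" 0 1 w] that by (simp add: a_def)
  define b where "b n = (cmod (a n))\<^sup>2 / (real n + 1)" for n
  have b_nonneg: "0 \<le> b n" for n by (simp add: b_def)
  have area: "disc_area f = (\<Sum>n. ennreal (pi * b n))"
  proof -
    have "disc_area f = (\<Sum>n. ennreal (pi * (cmod (a n))\<^sup>2 / (real n + 1)))"
      by (rule disc_area_power_series) (rule sums)
    then show ?thesis
      unfolding b_def times_divide_eq_right .
  qed
  \<comment> \<open>Here finiteness of the area enters: it turns the extended sum into a convergent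
    real series.\<close>
  have summ: "summable (\<lambda>n. pi * b n)"
  proof (rule summable_suminf_not_top)
    show "(\<Sum>n. ennreal (pi * b n)) \<noteq> top"
      using fin unfolding area by (auto simp only: infinity_ennreal_def)
  qed (simp add: b_nonneg)
  then have summ_b: "summable b"
    by (simp add: summable_cmult_iff)
  have "disc_area f = ennreal (pi * suminf b)"
    unfolding area suminf_mult[OF summ_b, symmetric] using summ b_nonneg
    by (intro suminf_ennreal2) auto
  then have area': "enn2real (disc_area f) = pi * suminf b"
    using b_nonneg summ_b by (simp add: suminf_nonneg)
  have "(cmod (deriv f z) * (1 - (cmod z)\<^sup>2))\<^sup>2 \<le> suminf b"
    unfolding b_def using z summ_b
    by (intro power_series_Cauchy_Schwarz sums) (auto simp: b_def[abs_def])
  \<comment> \<open>Dividing by \<open>hyp_density z\<close> is multiplying by half of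
    \<open>1 - (cmod z)\<^sup>2\<close>; the square of this half is the 4 under the root.\<close>
  then have "(cmod (deriv f z) / hyp_density z)\<^sup>2 \<le> enn2real (disc_area f) / (4 * pi)"
    by (simp add: area' hyp_density_def power_divide field_simps)
  then show ?thesis
    by (rule real_le_rsqrt)
qed

section \<open>The extremal disc automorphisms\<close>

text \<open>The derivative of the automorphism is a multiple of a differentiated geometric series,
  so its coefficients and its area are explicit. Prescribing \<open>f\<close> on the disc alone
  suffices, since derivatives at points of an open set are local.\<close>

lemma dirichlet_bound_sharp:
  assumes z: "z \<in> unit_disc"
    and f: "\<And>w. w \<in> unit_disc \<Longrightarrow> f w = (w - z) / (1 - cnj z * w)"
  shows "f analytic_on unit_disc" "disc_area f = ennreal pi"
    "cmod (deriv f z) / hyp_density z = 1 / 2"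
proof -
  have x: "(cmod z)\<^sup>2 < 1" using z by (simp add: abs_square_less_1)
  have small: "cmod (cnj z * w) < 1" if "w \<in> unit_disc" for w
    using that z mult_strict_mono'[of "cmod z" 1 "cmod w" 1] by (simp add: norm_mult)
  have nz: "1 - cnj z * w \<noteq> 0" if "w \<in> unit_disc" for w
    using small[OF that] by auto
  have zz: "z * cnj z = of_real ((cmod z)\<^sup>2)"
    by (simp only: complex_norm_square)
  \<comment> \<open>The numerator in the quotient rule is
    \<open>(1 - cnj z * w) + cnj z * (w - z) = 1 - z * cnj z\<close>.\<close>
  have der: "(f has_field_derivative of_real (1 - (cmod z)\<^sup>2) / (1 - cnj z * w)\<^sup>2) (at w)"
    if w: "w \<in> unit_disc" for w
  proof -
    have "((\<lambda>w. (w - z) / (1 - cnj z * w)) has_field_derivative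
        of_real (1 - (cmod z)\<^sup>2) / (1 - cnj z * w)\<^sup>2) (at w)"
      using nz[OF w] zz
      by (auto intro!: derivative_eq_intros simp: field_simps power2_eq_square)
    then show ?thesis
      by (rule has_field_derivative_transform_within_open[of _ _ _ unit_disc]) (use w f in auto)
  qed
  show "f analytic_on unit_disc"
    unfolding analytic_on_open[OF open_ball] holomorphic_on_open[OF open_ball] using der by blast
  have deriv_f: "deriv f w = of_real (1 - (cmod z)\<^sup>2) / (1 - cnj z * w)\<^sup>2" if "w \<in> unit_disc" for w
    using der[OF that] by (rule DERIV_imp_deriv)
  \<comment> \<open>Expand \<open>1 / (1 - q)\<^sup>2\<close> as the sum of
    \<open>(n + 1) * q ^ n\<close> with \<open>q = cnj z * w\<close>.\<close>
  let ?a = "\<lambda>n. of_real (1 - (cmod z)\<^sup>2) * of_nat (Suc n) * cnj z ^ n"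
  have "(\<lambda>n. ?a n * w ^ n) sums deriv f w" if "w \<in> unit_disc" for w
    using sums_mult[OF geometric_deriv_sums[OF small[OF that]], of "of_real (1 - (cmod z)\<^sup>2)"]
    unfolding deriv_f[OF that] by (simp add: power_mult_distrib mult_ac del: of_nat_Suc)
  then have "disc_area f = (\<Sum>n. ennreal (pi * (cmod (?a n))\<^sup>2 / (real n + 1)))"
    by (rule disc_area_power_series)
  \<comment> \<open>One factor \<open>n + 1\<close> cancels, which leaves the same type of series,
    now at \<open>(cmod z)\<^sup>2\<close>.\<close>
  also have "\<dots> = (\<Sum>n. ennreal (pi * (1 - (cmod z)\<^sup>2)\<^sup>2 * (real (Suc n) * ((cmod z)\<^sup>2) ^ n)))"
  proof (intro suminf_cong arg_cong[of _ _ ennreal])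
    fix n
    have "cmod (?a n) = (1 - (cmod z)\<^sup>2) * real (Suc n) * cmod z ^ n"
      using x by (simp only: norm_mult norm_power norm_of_real norm_of_nat complex_mod_cnj)
    moreover have "(cmod z ^ n)\<^sup>2 = ((cmod z)\<^sup>2) ^ n"
      by (simp add: power_mult[symmetric] mult.commute)
    ultimately show "pi * (cmod (?a n))\<^sup>2 / (real n + 1)
        = pi * (1 - (cmod z)\<^sup>2)\<^sup>2 * (real (Suc n) * ((cmod z)\<^sup>2) ^ n)"
      by (simp only: power_mult_distrib) (simp add: field_simps power2_eq_square)
  qed
  also have "\<dots> = ennreal (pi * (1 - (cmod z)\<^sup>2)\<^sup>2 * (1 / (1 - (cmod z)\<^sup>2)\<^sup>2))"
    using x by (intro suminf_ennreal_eq sums_mult geometric_deriv_sums) auto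
  also have "\<dots> = ennreal pi"
    using x by simp
  finally show "disc_area f = ennreal pi" .
  have "1 - cnj z * z = of_real (1 - (cmod z)\<^sup>2)"
    using zz by (simp add: mult.commute)
  then have "deriv f z = of_real (1 - (cmod z)\<^sup>2) / (of_real (1 - (cmod z)\<^sup>2))\<^sup>2"
    using deriv_f[OF z] by simp
  also have "\<dots> = of_real (1 / (1 - (cmod z)\<^sup>2))"
    using x by (simp add: power2_eq_square)
  finally have "cmod (deriv f z) = 1 / (1 - (cmod z)\<^sup>2)"
    using x by (simp only: norm_of_real) simp
  then show "cmod (deriv f z) / hyp_density z = 1 / 2"
    using x by (simp add: hyp_density_def)
qed

theorem theorem1p2:
  "(\<forall>f :: complex \<Rightarrow> complex. f analytic_on unit_disc \<longrightarrow> disc_area f < \<infinity> \<longrightarrow>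
      (\<forall>z \<in> unit_disc.
         cmod (deriv f z) / hyp_density z \<le> sqrt (enn2real (disc_area f) / (4 * pi)))) \<and>
   (\<forall>z \<in> unit_disc. \<forall>f :: complex \<Rightarrow> complex.
      (\<forall>w \<in> unit_disc. f w = (w - z) / (1 - cnj z * w)) \<longrightarrow>
      f analytic_on unit_disc \<and> disc_area f < \<infinity> \<and>
      cmod (deriv f z) / hyp_density z = sqrt (enn2real (disc_area f) / (4 * pi)))"
  (is "?bound \<and> ?sharp")
proof
  show ?bound
    by (blast intro: dirichlet_bound)
  \<comment> \<open>The area \<open>pi\<close> makes the right-hand side \<open>1 / 2\<close>, which
    is also the value of the quotient at \<open>z\<close>.\<close>
  have sqrt: "sqrt (enn2real (ennreal pi) / (4 * pi)) = 1 / 2"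
    by (simp add: real_sqrt_divide)
  show ?sharp
  proof (intro ballI allI impI)
    fix z f
    assume z: "z \<in> unit_disc" and "\<forall>w \<in> unit_disc. f w = (w - z) / (1 - cnj z * w)"
    then have f: "f w = (w - z) / (1 - cnj z * w)" if "w \<in> unit_disc" for w
      using that by blast
    show "f analytic_on unit_disc \<and> disc_area f < \<infinity> \<and>
        cmod (deriv f z) / hyp_density z = sqrt (enn2real (disc_area f) / (4 * pi))"
      using dirichlet_bound_sharp[OF z f] by (simp only: sqrt) simp
  qed
qed

end
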